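(* Let $n,m\in\mathbb{N}$, $M\in\mathbb{R}^{n\times m}$, $P\subset\{1,\dots,n\}\times\{1,\dots,m\}$, $\omega>0$. Let $A\in\mathbb{R}^{n\times m}$ with $r=\mathrm{rank}(A)\geq 1$ and let $A=U\Sigma V^T$ be a truncated SVD, $U\in\mathbb{R}^{n\times r}$, $\Sigma\in\mathbb{R}^{r\times r}$, $V^T\in\mathbb{R}^{r\times m}$. Let $C$ be the variational residual function defined in the context. Put $$\zeta_1=\frac{nr}{r(nr+rm+2)},\qquad\zeta_2=\frac{rm}{r(nr+rm+2)}.$$ Then the minimizer $X^+$ of $\widetilde X\mapsto C_{M,P,U\Sigma,V^T}(\widetilde X,V^T)$ is given by $$X^+_{i,:}=\mathrm{argmin}_{\widetilde X_{i,:}}\ \|\widetilde X_{i,:}V^T-M_{i,:}\|^2_{P_{i,:}}+\frac{|P_{i,:}|}{m}\,\omega^2\,\zeta_2\,\|\widetilde X_{i,:}\Sigma^{-1}\|_F^2,\qquad i=1,\dots,n,$$ where $P_{i,:}=\{p_2\mid p\in P,\ p_1=i\}$, and the minimizer $Y^+$ of $\widetilde Y\mapsto C_{M,P,U,\Sigma V^T}(U,\widetilde Y)$ is given by $$Y^+_{:,j}=\mathrm{argmin}_{\widetilde Y_{:,j}}\ \|U\widetilde Y_{:,j}-M_{:,j}\|^2_{P_{:,j}}+\frac{|P_{:,j}|}{n}\,\omega^2\,\zeta_1\,\|\Sigma^{-1}\widetilde Y_{:,j}\|_F^2,\qquad j=1,\dots,m,$$ where $P_{:,j}=\{p_1\mid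 p\in P,\ p_2=j\}$.
   Context: For an array $T$ and an index set $Q$, $\|T\|_Q^2:=\sum_{i\in Q}T_i^2$; $\|\cdot\|_F$ is the Frobenius norm; $T_{i,:}$ and $T_{:,j}$ denote the $i$-th row and $j$-th column. For $X\in\mathbb{R}^{n\times r}$, $Y\in\mathbb{R}^{r\times m}$ the variational residual function is $$C_{M,P,X,Y}(\widetilde X,\widetilde Y):=\int_{\mathbb{V}_\omega(X,Y)}\|(\widetilde X+\Delta X)(\widetilde Y+\Delta Y)-M\|_P^2\,\mathrm{d}\Delta X\,\mathrm{d}\Delta Y,\quad(\widetilde X,\widetilde Y)\in\mathbb{R}^{n\times r}\times\mathbb{R}^{r\times m},$$ $$\mathbb{V}_\omega(X,Y):=\{(\Delta X,\Delta Y)\in\mathbb{R}^{n\times r}\times\mathbb{R}^{r\times m}\mid\|\Delta X\,Y\|_F^2+\|X\,\Delta Y\|_F^2\le\omega^2\},$$ with respect to Lebesgue measure. If an argmin is not unique (only possible if some $P_{i,:}$, resp. $P_{:,j}$, is empty), the minimizer for which the resulting product ($\widetilde X V^T$, resp. $U\widetilde Y$) has smallest Frobenius norm is taken on both sides. *)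

theory Defs
  imports "HOL-Analysis.Analysis"
begin

text \<open>Matrices in \<open>\<real>\<^bsup>n\<times>m\<^esup>\<close> are elements of \<open>real ^ 'm ^ 'n\<close>.  On this type the library's
  \<^const>\<open>norm\<close> is the square root of the sum of all squared entries, i.e. the Frobenius norm.\<close>

definition sqnorm_on :: "'i set \<Rightarrow> ('i \<Rightarrow> real) \<Rightarrow> real" where
  "sqnorm_on Q T = (\<Sum>i\<in>Q. (T i)\<^sup>2)"

definition row_indices :: "('n \<times> 'm) set \<Rightarrow> 'n \<Rightarrow> 'm set" where
  "row_indices P i = {snd p | p. p \<in> P \<and> fst p = i}"

definition col_indices :: "('n \<times> 'm) set \<Rightarrow> 'm \<Rightarrow> 'n set" where
  "col_indices P j = {fst p | p. p \<in> P \<and> snd p = j}"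

text \<open>The index type \<open>'r\<close> carries no order, so the singular values are not required to be
  sorted; permuting them simultaneously with the columns of \<open>U\<close> and \<open>V\<close> is immaterial.\<close>

definition truncated_svd ::
  "real ^ 'm ^ 'n \<Rightarrow> real ^ 'r ^ 'n \<Rightarrow> real ^ 'r ^ 'r \<Rightarrow> real ^ 'r ^ 'm \<Rightarrow> bool" where
  "truncated_svd A U S V \<longleftrightarrow>
     A = U ** S ** transpose V \<and>
     transpose U ** U = mat 1 \<and>
     transpose V ** V = mat 1 \<and>
     (\<forall>k l. k \<noteq> l \<longrightarrow> S $ k $ l = 0) \<and>
     (\<forall>k. 0 < S $ k $ k)"

definition variation_set ::
  "real \<Rightarrow> real ^ 'r ^ 'n \<Rightarrow> real ^ 'm ^ 'r \<Rightarrow>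
    ((real ^ 'r ^ 'n) \<times> (real ^ 'm ^ 'r)) set" where
  "variation_set \<omega> X Y = {(DX, DY). (norm (DX ** Y))\<^sup>2 + (norm (X ** DY))\<^sup>2 \<le> \<omega>\<^sup>2}"

text \<open>The integrand is a polynomial, and the domain is compact whenever \<open>X\<close> has full column rank
  and \<open>Y\<close> has full row rank, so that the Bochner integral is then the actual Lebesgue integral and
  not the default value 0 for functions that are not integrable.\<close>

definition variational_residual ::
  "real \<Rightarrow> real ^ 'm ^ 'n \<Rightarrow> ('n \<times> 'm) set \<Rightarrow> real ^ 'r ^ 'n \<Rightarrow> real ^ 'm ^ 'r
    \<Rightarrow> real ^ 'r ^ 'n \<Rightarrow> real ^ 'm ^ 'r \<Rightarrow> real" where
  "variational_residual \<omega> M P X Y X' Y' =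
     set_lebesgue_integral lborel (variation_set \<omega> X Y)
       (\<lambda>(DX, DY). sqnorm_on P (\<lambda>(i, j). ((X' + DX) ** (Y' + DY) - M) $ i $ j))"

text \<open>All minimizers of \<open>g\<close> among the global minimizers of \<open>f\<close>: the argmin of \<open>f\<close>, where ties are
  broken by \<open>g\<close>.\<close>

definition tiebreak_argmin :: "('a \<Rightarrow> real) \<Rightarrow> ('a \<Rightarrow> real) \<Rightarrow> 'a set" where
  "tiebreak_argmin f g = {x. is_arg_min g (is_arg_min f (\<lambda>_. True)) x}"

end

theory Submission
  imports Defs
begin

text \<open>Since \<open>U\<close> and \<open>V\<close> have orthonormal columns, the variation set is an axis-parallel ellipsoid,
  symmetric under \<open>DX \<mapsto> -DX\<close> and \<open>DY \<mapsto> -DY\<close> separately.  Expanding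
  \<open>((X + DX)(V\<^sup>T + DY) - M)\<^sub>i\<^sub>j\<close>, every mixed term that depends on \<open>X\<close> is odd under one of the
  flips and integrates to zero.  What remains is the squared residual, the second moments of \<open>X DY\<close>,
  which give the ridge penalty, and a term independent of \<open>X\<close>.  The integral is therefore a positive
  multiple of the sum of the row objectives plus a constant, and it is minimised row by row; the
  column case is symmetric.\<close>

subsection \<open>Second moments of an ellipsoid\<close>

text \<open>For positive coefficients the semi-axis along \<open>b\<close> has length
  \<open>|w| / c b\<close>. Indexing the coefficients by basis vectors lets one definition cover
  pairs of matrices, where each entry gets its own weight.\<close>

definition ellipsoid :: "('a::euclidean_space \<Rightarrow> real) \<Rightarrow> real \<Rightarrow> 'a set" where
  "ellipsoid c w = {z. (\<Sum>b\<in>Basis. (c b * (z \<bullet> b))\<^sup>2) \<le> w\<^sup>2}"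

text \<open>Used in two ways: with factors of modulus 1 it is a reflection that preserves the
  ellipsoid, with one factor \<open>t\<close> and the others 1 it stretches along a single
  axis.\<close>

definition diag_map :: "('a::euclidean_space \<Rightarrow> real) \<Rightarrow> 'a \<Rightarrow> 'a" where
  "diag_map s z = (\<Sum>b\<in>Basis. (s b * (z \<bullet> b)) *\<^sub>R b)"

lemma diag_map_inner [simp]: "b \<in> Basis \<Longrightarrow> diag_map s z \<bullet> b = s b * (z \<bullet> b)"
  by (simp add: diag_map_def)

text \<open>Change of variables: the Jacobian determinant of a diagonal map has modulus the product
  of the \<open>\<bar>s b\<bar>\<close>.\<close>

lemma integral_lborel_diag_map:
  fixes f :: "'a::euclidean_space \<Rightarrow> real"
  assumes s: "\<And>b. b \<in> Basis \<Longrightarrow> s b \<noteq> 0" and f [measurable]: "f \<in> borel_measurable borel"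
  shows "integral\<^sup>L lborel f = (\<Prod>b\<in>Basis. \<bar>s b\<bar>) * integral\<^sup>L lborel (\<lambda>z. f (diag_map s z))"
proof -
  have [measurable]: "diag_map s \<in> borel_measurable borel"
    unfolding diag_map_def by measurable
  have "lborel = density (distr lborel borel (diag_map s)) (\<lambda>_. (\<Prod>b\<in>Basis. \<bar>s b\<bar>))"
    using lborel_affine_euclidean[of s 0] s by (simp add: diag_map_def[abs_def])
  then have "integral\<^sup>L lborel f =
      integral\<^sup>L (density (distr lborel borel (diag_map s)) (\<lambda>_. (\<Prod>b\<in>Basis. \<bar>s b\<bar>))) f"
    by simp
  also have "\<dots> = (\<Prod>b\<in>Basis. \<bar>s b\<bar>) * integral\<^sup>L lborel (\<lambda>z. f (diag_map s z))"
    by (simp add: integral_density integral_distr prod_nonneg)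
  finally show ?thesis .
qed

lemma set_lebesgue_integral_sum:
  fixes f :: "'i \<Rightarrow> 'a \<Rightarrow> real"
  assumes "\<And>i. i \<in> I \<Longrightarrow> set_integrable M A (f i)"
  shows "(LINT x:A|M. (\<Sum>i\<in>I. f i x)) = (\<Sum>i\<in>I. LINT x:A|M. f i x)"
  using assms unfolding set_lebesgue_integral_def set_integrable_def
  by (simp add: sum_distrib_left)

lemma diag_map_in_ellipsoid_iff:
  assumes "\<And>b. b \<in> Basis \<Longrightarrow> \<bar>s b\<bar> = 1"
  shows "diag_map s z \<in> ellipsoid c w \<longleftrightarrow> z \<in> ellipsoid c w"
proof -
  have "(s b)\<^sup>2 = 1" if "b \<in> Basis" for b
    using assms[OF that] by (metis one_power2 power2_abs)
  then have "(\<Sum>b\<in>Basis. (c b * (diag_map s z \<bullet> b))\<^sup>2) = (\<Sum>b\<in>Basis. (c b * (z \<bullet> b))\<^sup>2)"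
    by (intro sum.cong) (auto simp: power_mult_distrib)
  then show ?thesis by (simp add: ellipsoid_def)
qed

text \<open>Positive coefficients bound each coordinate by \<open>|w| / c b\<close>. Compactness
  yields the finite volume and the integrability of continuous functions on which the moment
  computations rest.\<close>

lemma compact_ellipsoid:
  fixes c :: "'a::euclidean_space \<Rightarrow> real"
  assumes c: "\<And>b. b \<in> Basis \<Longrightarrow> 0 < c b"
  shows "compact (ellipsoid c w)"
proof -
  have "closed (ellipsoid c w)"
    unfolding ellipsoid_def by (intro closed_Collect_le continuous_intros)
  moreover have "norm z \<le> (\<Sum>b\<in>Basis. \<bar>w\<bar> / c b)" if "z \<in> ellipsoid c w" for z
  proof -
    have "\<bar>z \<bullet> b\<bar> \<le> \<bar>w\<bar> / c b" if b: "b \<in> Basis" for b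
    proof -
      have "(c b * (z \<bullet> b))\<^sup>2 \<le> (\<Sum>b\<in>Basis. (c b * (z \<bullet> b))\<^sup>2)"
        by (rule member_le_sum[OF b]) auto
      also have "\<dots> \<le> w\<^sup>2" using \<open>z \<in> ellipsoid c w\<close> by (simp add: ellipsoid_def)
      finally have "\<bar>c b * (z \<bullet> b)\<bar> \<le> \<bar>w\<bar>" by (simp add: abs_le_square_iff)
      then show ?thesis using c[OF b] by (simp add: abs_mult field_simps)
    qed
    then show ?thesis
      by (intro order.trans[OF norm_le_l1 sum_mono]) auto
  qed
  ultimately show ?thesis
    by (auto simp: compact_eq_bounded_closed bounded_iff)
qed

text \<open>Lets the simplifier discharge the continuity conditions behind integrability while it
  splits integrals of polynomial expressions.\<close>

lemmas continuous_on_polynomial_simps = continuous_on_add continuous_on_diff continuous_on_mult continuous_on_power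
  continuous_on_inner continuous_on_const continuous_on_id

lemma set_integrable_ellipsoid:
  fixes c :: "'a::euclidean_space \<Rightarrow> real" and f :: "'a \<Rightarrow> real"
  assumes "\<And>b. b \<in> Basis \<Longrightarrow> 0 < c b" and "continuous_on UNIV f"
  shows "set_integrable lborel (ellipsoid c w) f"
  unfolding set_integrable_def
  by (rule borel_integrable_compact[OF compact_ellipsoid])
     (use assms in \<open>auto intro: continuous_on_subset\<close>)

text \<open>The ellipsoid contains an open neighbourhood of 0, which is not negligible. This volume
  becomes the factor in front of the objectives, so its sign decides that minimisers are
  preserved.\<close>

lemma measure_ellipsoid_pos:
  fixes c :: "'a::euclidean_space \<Rightarrow> real"
  assumes c: "\<And>b. b \<in> Basis \<Longrightarrow> 0 < c b" and "0 < w"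
  shows "0 < measure lborel (ellipsoid c w)"
proof (rule ccontr)
  let ?O = "{z::'a. (\<Sum>b\<in>Basis. (c b * (z \<bullet> b))\<^sup>2) < w\<^sup>2}"
  assume "\<not> ?thesis"
  then have "measure lborel (ellipsoid c w) = 0"
    by (simp add: zero_less_measure_iff)
  \<comment> \<open>\<open>measure\<close> is also 0 on sets of infinite measure; compactness
    excludes that case.\<close>
  moreover have "emeasure lborel (ellipsoid c w) < \<infinity>"
    using c by (intro emeasure_compact_finite compact_ellipsoid)
  ultimately have "emeasure lborel (ellipsoid c w) = 0"
    by (auto simp: measure_def enn2real_eq_0_iff)
  moreover have "ellipsoid c w \<in> sets lborel"
    using borel_compact[OF compact_ellipsoid[of c w]] c by simp
  ultimately have "ellipsoid c w \<in> null_sets lebesgue"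
    by (metis null_sets_completionI null_setsI)
  then have "negligible (ellipsoid c w)"
    by (simp add: negligible_iff_null_sets)
  then have "negligible ?O"
    by (rule negligible_subset) (auto simp: ellipsoid_def)
  moreover have "open ?O"
    by (intro open_Collect_less continuous_intros)
  moreover have "0 \<in> ?O" using \<open>0 < w\<close> by simp
  ultimately show False using open_not_negligible by blast
qed

text \<open>A reflection preserves both Lebesgue measure and the ellipsoid, so the integral of an
  odd function equals its own negative.\<close>

lemma set_integral_ellipsoid_flip:
  fixes c :: "'a::euclidean_space \<Rightarrow> real" and f :: "'a \<Rightarrow> real"
  assumes c: "\<And>b. b \<in> Basis \<Longrightarrow> 0 < c b" and f: "continuous_on UNIV f"
    and s: "\<And>b. b \<in> Basis \<Longrightarrow> \<bar>s b\<bar> = 1"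
    and odd: "\<And>z. f (diag_map s z) = - f z"
  shows "(LINT z:ellipsoid c w|lborel. f z) = 0"
proof -
  have [measurable]: "ellipsoid c w \<in> sets borel" "f \<in> borel_measurable borel"
    using borel_compact[OF compact_ellipsoid[of c w]] c f
    by (auto intro: borel_measurable_continuous_onI)
  have s0: "\<And>b. b \<in> Basis \<Longrightarrow> s b \<noteq> 0" using s by force
  have p: "(\<Prod>b\<in>Basis. \<bar>s b\<bar>) = 1" using s by simp
  have ind: "indicator (ellipsoid c w) (diag_map s z) = (indicator (ellipsoid c w) z :: real)" for z
    using diag_map_in_ellipsoid_iff[of s z c w, OF s] by (simp add: indicator_def)
  have "integral\<^sup>L lborel (\<lambda>z. indicator (ellipsoid c w) z * f z)
      = integral\<^sup>L lborel (\<lambda>z. indicator (ellipsoid c w) z * - f z)"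
    by (subst integral_lborel_diag_map[OF s0]) (auto simp: p odd ind)
  then show ?thesis by (simp add: set_lebesgue_integral_def)
qed

text \<open>Among all sets, the ellipsoid \<open>E = {q \<le> w\<^sup>2}\<close> minimises the integral of \<open>q - w\<^sup>2\<close>.
  Stretching \<open>E\<close> by a factor \<open>t\<close> along one axis thus gives a function of \<open>t\<close> that is stationary at
  \<open>t = 1\<close>, which expresses the moment along that axis through the integral of \<open>q\<close>, the sum of all
  axis moments.\<close>
lemma second_moment_ellipsoid_diag:
  fixes c :: "'a::euclidean_space \<Rightarrow> real"
  assumes c: "\<And>b. b \<in> Basis \<Longrightarrow> 0 < c b" and b: "b \<in> Basis"
  shows "(LINT z:ellipsoid c w|lborel. (c b * (z \<bullet> b))\<^sup>2)
    = w\<^sup>2 / (real DIM('a) + 2) * measure lborel (ellipsoid c w)"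
proof -
  let ?E = "ellipsoid c w"
  define q where "q z = (\<Sum>b\<in>Basis. (c b * (z \<bullet> b))\<^sup>2)" for z
  define m where "m b = (LINT z:?E|lborel. (c b * (z \<bullet> b))\<^sup>2)" for b
  define G where "G = (LINT z:?E|lborel. q z)"
  define vol where "vol = measure lborel ?E"
  have cq: "continuous_on UNIV q" unfolding q_def by (intro continuous_intros)
  have fin: "emeasure lborel ?E < \<infinity>"
    using c by (intro emeasure_compact_finite compact_ellipsoid)
  have const: "(LINT z:?E|lborel. a) = a * vol" for a :: real
    unfolding vol_def set_lebesgue_integral_def by simp
  note int = set_integrable_ellipsoid[OF c]
  have G: "G = (\<Sum>b\<in>Basis. m b)"
    unfolding G_def m_def q_def
    by (intro set_lebesgue_integral_sum int continuous_intros)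
  have stat: "G - w\<^sup>2 * vol + 2 * m b = 0" if b: "b \<in> Basis" for b
  proof -
    \<comment> \<open>\<open>\<phi> t\<close> is the integral of \<open>q z - w\<^sup>2\<close> over
      the ellipsoid stretched by \<open>t\<close> along \<open>b\<close>: the leading
      \<open>t\<close> is the Jacobian, and stretching adds \<open>t\<^sup>2 - 1\<close> times the
      \<open>b\<close>-th summand to \<open>q\<close>. Both facts are shown below as
      \<open>ps\<close> and \<open>qs\<close>.\<close>
    define \<phi> where "\<phi> t = t * (G + (t\<^sup>2 - 1) * m b - w\<^sup>2 * vol)" for t
    have min: "\<phi> 1 \<le> \<phi> t" if t: "0 < t" for t
    proof -
      define s where "s = (\<lambda>_. 1)(b := t)"
      define F where "F = ellipsoid (\<lambda>b. c b / s b) w"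
      have s: "s b > 0" for b using t by (simp add: s_def)
      then have s0: "s b \<noteq> 0" for b by (simp add: less_imp_neq[symmetric])
      have csF: "0 < c b / s b" if "b \<in> Basis" for b
        using c[OF that] s by simp
      have [measurable]: "?E \<in> sets borel" "F \<in> sets borel" "q \<in> borel_measurable borel"
        using borel_compact[OF compact_ellipsoid[of c w]] c
          borel_compact[OF compact_ellipsoid[of "\<lambda>b. c b / s b" w]] csF cq
        by (auto simp: F_def intro: borel_measurable_continuous_onI)
      have inF: "diag_map s z \<in> F \<longleftrightarrow> z \<in> ?E" for z
        using s0 by (simp add: F_def ellipsoid_def)
      have qs: "q (diag_map s z) = q z + (t\<^sup>2 - 1) * (c b * (z \<bullet> b))\<^sup>2" for z
      proof -
        have "q (diag_map s z) = (\<Sum>i\<in>Basis. (c i * (z \<bullet> i))\<^sup>2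
            + (if i = b then (t\<^sup>2 - 1) * (c b * (z \<bullet> b))\<^sup>2 else 0))"
          unfolding q_def by (intro sum.cong) (auto simp: s_def power_mult_distrib algebra_simps)
        then show ?thesis using b by (simp add: sum.distrib q_def)
      qed
      have ps: "(\<Prod>i\<in>Basis. \<bar>s i\<bar>) = t"
      proof -
        have "(\<Prod>i\<in>Basis. \<bar>s i\<bar>) = (\<Prod>i\<in>Basis. if i = b then t else 1)"
          using t by (intro prod.cong) (auto simp: s_def)
        then show ?thesis using b by simp
      qed
      have eqE: "(LINT z:?E|lborel. q z - w\<^sup>2) = \<phi> 1"
        by (subst set_integral_diff)
          (auto simp: const G_def \<phi>_def intro!: int cq continuous_intros)
      have "(LINT z:F|lborel. q z - w\<^sup>2) = t * (LINT z:?E|lborel. q (diag_map s z) - w\<^sup>2)"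
        unfolding set_lebesgue_integral_def
        by (subst integral_lborel_diag_map[where s = s, OF s0]) (auto simp: ps inF indicator_def)
      also have "(LINT z:?E|lborel. q (diag_map s z) - w\<^sup>2)
          = (LINT z:?E|lborel. (q z + (t\<^sup>2 - 1) * (c b * (z \<bullet> b))\<^sup>2) - w\<^sup>2)"
        by (simp add: qs)
      also have "\<dots> = G + (t\<^sup>2 - 1) * m b - w\<^sup>2 * vol"
        by (simp add: set_integral_add(2) set_integral_diff(2) int cq continuous_on_polynomial_simps const G_def m_def)
      finally have eqF: "(LINT z:F|lborel. q z - w\<^sup>2) = \<phi> t" by (simp add: \<phi>_def)
      \<comment> \<open>The integrand is nonpositive exactly on the ellipsoid, so passing to any
        other region drops nonpositive values or adds positive ones.\<close>
      have "(LINT z:?E|lborel. q z - w\<^sup>2) \<le> (LINT z:F|lborel. q z - w\<^sup>2)"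
        unfolding set_lebesgue_integral_def
      proof (rule integral_mono)
        show "integrable lborel (\<lambda>z. indicat_real ?E z *\<^sub>R (q z - w\<^sup>2))"
          by (intro int[unfolded set_integrable_def] continuous_intros cq)
        show "integrable lborel (\<lambda>z. indicat_real F z *\<^sub>R (q z - w\<^sup>2))"
          unfolding F_def using csF
          by (intro set_integrable_ellipsoid[unfolded set_integrable_def] continuous_intros cq)
        show "indicat_real ?E z *\<^sub>R (q z - w\<^sup>2) \<le> indicat_real F z *\<^sub>R (q z - w\<^sup>2)" for z
          by (auto simp: ellipsoid_def q_def indicator_def)
      qed
      then show ?thesis by (simp add: eqE eqF)
    qed
    have "(\<phi> has_real_derivative (G - w\<^sup>2 * vol + 2 * m b)) (at 1)"
      unfolding \<phi>_def[abs_def] by (auto intro!: derivative_eq_intros simp: algebra_simps)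
    \<comment> \<open>Radius 1 keeps \<open>y\<close> positive, which is where \<open>min\<close>
      applies.\<close>
    moreover have "\<forall>y. \<bar>1 - y\<bar> < 1 \<longrightarrow> \<phi> 1 \<le> \<phi> y"
      by (intro allI impI min) linarith
    ultimately show ?thesis using DERIV_local_min[of \<phi> _ 1 1] by auto
  qed
  \<comment> \<open>The stationarity equation has the same \<open>G\<close> for every axis, so all
    axis moments agree and \<open>G\<close> is the dimension times any one of them. Substituting
    back produces the denominator, dimension plus 2.\<close>
  have "m i = m b" if "i \<in> Basis" for i
    using stat[OF that] stat[OF b] by simp
  then have "G = real DIM('a) * m b" using G by simp
  with stat[OF b] have "(real DIM('a) + 2) * m b = w\<^sup>2 * vol" by (simp add: algebra_simps)
  moreover have "real DIM('a) + 2 > 0" by simp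
  ultimately show ?thesis unfolding m_def[symmetric] vol_def[symmetric]
    by (simp add: field_simps)
qed

text \<open>Expanding \<open>z \<bullet> u\<close> in coordinates gives a double sum: off-diagonal
  products vanish on reflecting one coordinate, and diagonal ones are the axis moments divided by
  \<open>(c b)\<^sup>2\<close>.\<close>

lemma second_moment_ellipsoid:
  fixes c :: "'a::euclidean_space \<Rightarrow> real"
  assumes c: "\<And>b. b \<in> Basis \<Longrightarrow> 0 < c b"
  shows "(LINT z:ellipsoid c w|lborel. (z \<bullet> u)\<^sup>2)
    = w\<^sup>2 / (real DIM('a) + 2) * (\<Sum>b\<in>Basis. (u \<bullet> b / c b)\<^sup>2) * measure lborel (ellipsoid c w)"
proof -
  let ?E = "ellipsoid c w"
  note int = set_integrable_ellipsoid[OF c]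
  have off: "(LINT z:?E|lborel. (z \<bullet> i) * (z \<bullet> j)) = 0" if "i \<in> Basis" "j \<in> Basis" "i \<noteq> j" for i j
    by (rule set_integral_ellipsoid_flip[OF c, where s = "\<lambda>b. if b = i then -1 else 1"])
       (use that in \<open>auto intro!: continuous_intros\<close>)
  have diag: "(LINT z:?E|lborel. (z \<bullet> b) * (z \<bullet> b)) = w\<^sup>2 / (real DIM('a) + 2) * measure lborel ?E / (c b)\<^sup>2"
    if "b \<in> Basis" for b
  proof -
    have "(c b)\<^sup>2 * (LINT z:?E|lborel. (z \<bullet> b) * (z \<bullet> b)) = (LINT z:?E|lborel. (c b * (z \<bullet> b))\<^sup>2)"
      by (simp add: power_mult_distrib power2_eq_square[of "_ \<bullet> _"])
    also note second_moment_ellipsoid_diag[OF c that]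
    finally show ?thesis using c[OF that]
      by (simp add: eq_divide_eq ac_simps)
  qed
  have "(z \<bullet> u)\<^sup>2 = (\<Sum>i\<in>Basis. \<Sum>j\<in>Basis. (u \<bullet> i) * (u \<bullet> j) * ((z \<bullet> i) * (z \<bullet> j)))" for z :: 'a
    unfolding euclidean_inner[of z u] power2_eq_square sum_product
    by (simp add: ac_simps)
  then have "(LINT z:?E|lborel. (z \<bullet> u)\<^sup>2)
      = (\<Sum>i\<in>Basis. \<Sum>j\<in>Basis. (u \<bullet> i) * (u \<bullet> j) * (LINT z:?E|lborel. (z \<bullet> i) * (z \<bullet> j)))"
    by (simp add: set_lebesgue_integral_sum int continuous_on_polynomial_simps continuous_on_sum)
  also have "\<dots> = (\<Sum>i\<in>Basis. \<Sum>j\<in>Basis. if j = i then (u \<bullet> i)\<^sup>2 * (w\<^sup>2 / (real DIM('a) + 2) * measure lborel ?E / (c i)\<^sup>2) else 0)"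
    by (intro sum.cong) (auto simp: off diag power2_eq_square)
  also have "\<dots> = w\<^sup>2 / (real DIM('a) + 2) * (\<Sum>b\<in>Basis. (u \<bullet> b / c b)\<^sup>2) * measure lborel ?E"
    by (simp add: sum_distrib_left sum_distrib_right power_divide mult_ac)
  finally show ?thesis .
qed

text \<open>Parity removes all cross terms: \<open>z \<bullet> u\<close> is odd under
  \<open>z \<mapsto> -z\<close>, and \<open>h\<close> is odd under a reflection that fixes
  \<open>z \<bullet> u\<close>. The integral of the square of \<open>h\<close> stays unevaluated,
  since in the application it is independent of the unknown matrix.\<close>

lemma set_integral_ellipsoid_square:
  fixes c :: "'a::euclidean_space \<Rightarrow> real" and h :: "'a \<Rightarrow> real"
  assumes c: "\<And>b. b \<in> Basis \<Longrightarrow> 0 < c b" and h: "continuous_on UNIV h"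
    and s: "\<And>b. b \<in> Basis \<Longrightarrow> \<bar>s b\<bar> = 1"
    and odd: "\<And>z. h (diag_map s z) = - h z"
    and even: "\<And>z. diag_map s z \<bullet> u = z \<bullet> u"
  shows "(LINT z:ellipsoid c w|lborel. (a + z \<bullet> u + h z)\<^sup>2)
    = (a\<^sup>2 + w\<^sup>2 / (real DIM('a) + 2) * (\<Sum>b\<in>Basis. (u \<bullet> b / c b)\<^sup>2)) * measure lborel (ellipsoid c w)
      + (LINT z:ellipsoid c w|lborel. (h z)\<^sup>2)"
proof -
  let ?E = "ellipsoid c w"
  note int = set_integrable_ellipsoid[OF c]
  have neg: "diag_map (\<lambda>_. -1) z = - z" for z :: 'a
    by (rule euclidean_eqI) simp
  have 1: "(LINT z:?E|lborel. z \<bullet> u) = 0"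
    by (rule set_integral_ellipsoid_flip[OF c, where s = "\<lambda>_. -1"])
       (auto simp: neg intro!: continuous_intros)
  have 2: "(LINT z:?E|lborel. (a + z \<bullet> u) * h z) = 0"
    by (rule set_integral_ellipsoid_flip[OF c _ s]) (auto simp: odd even intro!: continuous_intros h)
  have 3: "(LINT z:?E|lborel. (z \<bullet> u)\<^sup>2)
      = w\<^sup>2 / (real DIM('a) + 2) * (\<Sum>b\<in>Basis. (u \<bullet> b / c b)\<^sup>2) * measure lborel ?E"
    by (rule second_moment_ellipsoid[OF c])
  have "(a + z \<bullet> u + h z)\<^sup>2 = a\<^sup>2 + (z \<bullet> u)\<^sup>2 + (h z)\<^sup>2 + 2 * a * (z \<bullet> u) + 2 * ((a + z \<bullet> u) * h z)" for z
    by (simp add: power2_eq_square algebra_simps)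
  then have "(LINT z:?E|lborel. (a + z \<bullet> u + h z)\<^sup>2)
    = (LINT z:?E|lborel. a\<^sup>2) + (LINT z:?E|lborel. (z \<bullet> u)\<^sup>2) + (LINT z:?E|lborel. (h z)\<^sup>2)
      + 2 * a * (LINT z:?E|lborel. z \<bullet> u) + 2 * (LINT z:?E|lborel. (a + z \<bullet> u) * h z)"
    by (simp add: set_integral_add(2) int h continuous_on_polynomial_simps)
  also have "(LINT z:?E|lborel. a\<^sup>2) = a\<^sup>2 * measure lborel ?E"
    by (simp add: set_lebesgue_integral_def)
  finally show ?thesis
    unfolding 1 2 3 by (simp add: algebra_simps)
qed

text \<open>The form that fits the residual: \<open>a p\<close> is an entry of the unperturbed
  residual, \<open>z \<bullet> u p\<close> the term linear in the unknown, and one reflection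
  \<open>s\<close> serves all entries.\<close>

lemma set_integral_ellipsoid_sum_squares:
  fixes c :: "'a::euclidean_space \<Rightarrow> real" and h :: "'i \<Rightarrow> 'a \<Rightarrow> real"
  assumes c: "\<And>b. b \<in> Basis \<Longrightarrow> 0 < c b" and h: "\<And>p. continuous_on UNIV (h p)"
    and s: "\<And>b. b \<in> Basis \<Longrightarrow> \<bar>s b\<bar> = 1"
    and odd: "\<And>p z. h p (diag_map s z) = - h p z"
    and even: "\<And>p z. diag_map s z \<bullet> u p = z \<bullet> u p"
  shows "(LINT z:ellipsoid c w|lborel. (\<Sum>p\<in>P. (a p + z \<bullet> u p + h p z)\<^sup>2))
    = measure lborel (ellipsoid c w) *
        (\<Sum>p\<in>P. (a p)\<^sup>2 + w\<^sup>2 / (real DIM('a) + 2) * (\<Sum>b\<in>Basis. (u p \<bullet> b / c b)\<^sup>2))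
      + (\<Sum>p\<in>P. LINT z:ellipsoid c w|lborel. (h p z)\<^sup>2)"
proof -
  have "(LINT z:ellipsoid c w|lborel. (\<Sum>p\<in>P. (a p + z \<bullet> u p + h p z)\<^sup>2))
      = (\<Sum>p\<in>P. LINT z:ellipsoid c w|lborel. (a p + z \<bullet> u p + h p z)\<^sup>2)"
    by (intro set_lebesgue_integral_sum set_integrable_ellipsoid[OF c] continuous_intros h)
  also have "\<dots> = (\<Sum>p\<in>P. ((a p)\<^sup>2 + w\<^sup>2 / (real DIM('a) + 2) * (\<Sum>b\<in>Basis. (u p \<bullet> b / c b)\<^sup>2))
      * measure lborel (ellipsoid c w) + (LINT z:ellipsoid c w|lborel. (h p z)\<^sup>2))"
    by (intro sum.cong refl set_integral_ellipsoid_square[OF c h s odd even])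
  finally show ?thesis
    by (simp add: sum.distrib sum_distrib_right[symmetric] mult.commute[of "measure _ _"])
qed

subsection \<open>Minimisers with tie-breaking\<close>

lemma tiebreak_argmin_iff:
  "x \<in> tiebreak_argmin f g \<longleftrightarrow>
     (\<forall>y. f x \<le> f y) \<and> (\<forall>y. (\<forall>z. f y \<le> f z) \<longrightarrow> g x \<le> g y)"
  by (auto simp: tiebreak_argmin_def is_arg_min_def not_less)

lemma tiebreak_argmin_unique:
  assumes "\<And>y. f x \<le> f y" and "\<And>y. f y \<le> f x \<Longrightarrow> y = x"
  shows "tiebreak_argmin f g = {x}"
  using assms by (fastforce simp: tiebreak_argmin_iff set_eq_iff)

text \<open>The range of \<open>L\<close> is a closed subspace, so \<open>b\<close> has exactly one
  closest point in it, and injectivity pulls that point back to a single minimiser.\<close>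

lemma tiebreak_argmin_least_squares:
  fixes L :: "'a::euclidean_space \<Rightarrow> 'b::euclidean_space"
  assumes L: "linear L" "inj L" and f: "\<And>x. f x = (norm (L x - b))\<^sup>2"
  shows "\<exists>x. tiebreak_argmin f g = {x}"
proof -
  have S: "convex (range L)" "closed (range L)" "range L \<noteq> {}"
    using L by (auto simp: subspace_imp_convex closed_subspace linear_subspace_image[where S = UNIV, simplified])
  obtain x where x: "closest_point (range L) b = L x"
    using closest_point_in_set[OF S(2,3)] by auto
  have f': "f y = (dist b (L y))\<^sup>2" for y
    by (simp add: f dist_norm norm_minus_commute)
  have "f x \<le> f y" for y
    using closest_point_le[OF S(2), of "L y" b] by (simp add: f' x power_mono)
  moreover have "y = x" if "f y \<le> f x" for y
  proof -
    have le: "dist b (L y) \<le> dist b (L x)" using that by (simp add: f' power2_le_iff_abs_le)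
    have "\<forall>z\<in>range L. dist b (L y) \<le> dist b z"
      using le closest_point_le[OF S(2), of _ b] x by fastforce
    then have "L y = closest_point (range L) b"
      by (intro closest_point_unique[OF S(1,2)]) auto
    then show ?thesis using x L(2) by (simp add: inj_eq)
  qed
  ultimately show ?thesis using tiebreak_argmin_unique by metis
qed

text \<open>The case of a row or column without observed entries: every vector minimises the
  objective, and the tie-break selects 0.\<close>

lemma tiebreak_argmin_zero_norm:
  assumes "\<And>x. f x = 0" and "\<And>x. norm (g x) = norm x"
  shows "tiebreak_argmin f (\<lambda>x. norm (g x)) = {0 :: 'a :: real_normed_vector}"
  using assms by (auto simp: tiebreak_argmin_iff set_eq_iff) (metis norm_le_zero_iff norm_zero)

lemma sum_mono_imp_eq:
  fixes a b :: "'i::finite \<Rightarrow> real"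
  assumes "\<And>i. a i \<le> b i" and "(\<Sum>i\<in>UNIV. b i) \<le> (\<Sum>i\<in>UNIV. a i)"
  shows "b i = a i"
proof -
  have "(\<Sum>i\<in>UNIV. b i - a i) = 0"
    using assms sum_mono[of UNIV a b] by (simp add: sum_subtractf)
  then have "\<forall>i\<in>UNIV. b i - a i = 0"
    by (subst (asm) sum_nonneg_eq_0_iff) (auto simp: assms)
  then show ?thesis by simp
qed

text \<open>A sum over independent components is minimal exactly when every summand is. The
  tie-break separates in the same way once it is squared, as a Frobenius norm does into norms of
  rows or columns. Bijectivity of \<open>\<rho>\<close> allows the component minimisers to be
  assembled freely.\<close>

lemma tiebreak_argmin_separable:
  fixes \<rho> :: "'x \<Rightarrow> 'i::finite \<Rightarrow> 'y"
  assumes \<rho>: "bij \<rho>"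
    and f: "\<And>X. f X = c * (\<Sum>i\<in>UNIV. F i (\<rho> X i)) + K" and c: "0 < c"
    and g: "\<And>X. (g X)\<^sup>2 = (\<Sum>i\<in>UNIV. (G i (\<rho> X i))\<^sup>2)" "\<And>X. 0 \<le> g X" "\<And>i y. 0 \<le> G i y"
    and ex: "\<And>i. \<exists>x. tiebreak_argmin (F i) (G i) = {x}"
  shows "\<exists>X. tiebreak_argmin f g = {X} \<and> (\<forall>i. tiebreak_argmin (F i) (G i) = {\<rho> X i})"
proof -
  obtain x where x: "\<And>i. tiebreak_argmin (F i) (G i) = {x i}" using ex by metis
  obtain X where X: "\<rho> X = x" using bij_pointE[OF \<rho>] by metis
  have min: "F i (x i) \<le> F i y" for i y
    using x[of i] tiebreak_argmin_iff[of "x i" "F i" "G i"] by blast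
  have Gmin: "G i (x i) \<le> G i y" if "F i y = F i (x i)" for i y
    using x[of i] tiebreak_argmin_iff[of "x i" "F i" "G i"] that min by (metis singletonI)
  have uniq: "y = x i" if "F i y = F i (x i)" "G i y = G i (x i)" for i y
  proof -
    have "y \<in> tiebreak_argmin (F i) (G i)"
      unfolding tiebreak_argmin_iff that using min Gmin by (metis order.antisym)
    then show ?thesis using x by simp
  qed
  have fX: "f X \<le> f Z" for Z
    using c by (auto simp: f X intro!: sum_mono min)
  \<comment> \<open>A global minimiser has the same total as the componentwise minimum, and equal
    sums of ordered summands force equality of each.\<close>
  have Feq: "F i (\<rho> Z i) = F i (x i)" if "f Z \<le> f X" for Z i
    by (rule sum_mono_imp_eq[of "\<lambda>i. F i (x i)"]) (use that c in \<open>auto simp: f X min\<close>)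
  have Gle: "(G i (x i))\<^sup>2 \<le> (G i (\<rho> Z i))\<^sup>2" if "f Z \<le> f X" for Z i
    by (intro power_mono Gmin Feq that g)
  have gX: "g X \<le> g Z" if "f Z \<le> f X" for Z
    by (rule power2_le_imp_le[OF _ g(2)]) (auto simp: g(1) X intro!: sum_mono Gle that)
  \<comment> \<open>The same comparison of sums, now for the squared tie-break values, shows that
    every component of \<open>Z\<close> also attains the minimal tie-break value;
    \<open>uniq\<close> then identifies it.\<close>
  have "Z = X" if "f Z \<le> f X" "g Z \<le> g X" for Z
  proof -
    have "(g Z)\<^sup>2 \<le> (g X)\<^sup>2" using that g(2) by (intro power_mono) auto
    then have "(G i (\<rho> Z i))\<^sup>2 = (G i (x i))\<^sup>2" for i
      by (intro sum_mono_imp_eq[of "\<lambda>i. (G i (x i))\<^sup>2"] Gle that) (simp add: g(1) X)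
    then have "G i (\<rho> Z i) = G i (x i)" for i
      using g(3) by (metis power2_eq_iff_nonneg)
    then have "\<rho> Z = x" using uniq Feq that by blast
    then show ?thesis using X \<rho> by (metis bij_pointE)
  qed
  then have "tiebreak_argmin f g = {X}"
    using fX gX by (auto simp: tiebreak_argmin_iff set_eq_iff)
  then show ?thesis using x X by auto
qed

text \<open>For nonempty \<open>Q\<close> the penalty has positive weight and turns the objective
  into an injective least-squares problem. For empty \<open>Q\<close> the factor
  \<open>card Q\<close> removes the penalty too, and the tie-break decides.\<close>

lemma tiebreak_argmin_ridge:
  fixes A :: "'a::euclidean_space \<Rightarrow> real ^ 'm" and B :: "'a \<Rightarrow> 'b::euclidean_space"
    and g :: "'a \<Rightarrow> 'c::real_normed_vector"
  assumes A: "linear A" and B: "linear B" "inj B" and t: "0 < t"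
    and f: "\<And>x. f x = sqnorm_on Q (\<lambda>j. (A x - y) $ j) + real (card Q) * t * (norm (B x))\<^sup>2"
    and g: "\<And>x. norm (g x) = norm x"
  shows "\<exists>x. tiebreak_argmin f (\<lambda>x. norm (g x)) = {x}"
proof (cases "Q = {}")
  case True
  then have "f x = 0" for x by (simp add: f sqnorm_on_def)
  then show ?thesis using tiebreak_argmin_zero_norm g by metis
next
  case False
  define \<kappa> where "\<kappa> = real (card Q) * t"
  have \<kappa>: "0 < \<kappa>" using False t by (simp add: \<kappa>_def card_gt_0_iff)
  \<comment> \<open>The fit masked to \<open>Q\<close> is stacked on the scaled penalty; injectivity
    comes from the second component alone.\<close>
  define L where "L x = ((\<chi> j. if j \<in> Q then A x $ j else 0) :: real ^ 'm, sqrt \<kappa> *\<^sub>R B x)" for x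
  define b where "b = ((\<chi> j. if j \<in> Q then y $ j else 0) :: real ^ 'm, 0 :: 'b)"
  have "linear L"
    by (rule linearI)
      (auto simp: L_def vec_eq_iff linear_add[OF A] linear_add[OF B(1)] linear_scale[OF A]
        linear_scale[OF B(1)] scaleR_add_right)
  moreover have "inj L"
    using \<kappa> B(2) by (auto simp: L_def inj_def)
  moreover have "f x = (norm (L x - b))\<^sup>2" for x
  proof -
    have "(norm (L x - b))\<^sup>2 = (\<Sum>j\<in>UNIV. if j \<in> Q then ((A x - y) $ j)\<^sup>2 else 0) + \<kappa> * (norm (B x))\<^sup>2"
      using \<kappa> by (auto simp: L_def b_def norm_Pair norm_vec_def L2_set_def sum_nonneg power_mult_distrib
          intro!: sum.cong)
    also have "(\<Sum>j\<in>UNIV. if j \<in> Q then ((A x - y) $ j)\<^sup>2 else 0) = sqnorm_on Q (\<lambda>j. (A x - y) $ j)"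
      by (simp add: sqnorm_on_def sum.If_cases)
    finally show ?thesis by (simp add: f \<kappa>_def)
  qed
  ultimately show ?thesis by (rule tiebreak_argmin_least_squares)
qed

subsection \<open>Matrices\<close>

lemma power2_norm_matrix:
  fixes A :: "real ^ 'm ^ 'n"
  shows "(norm A)\<^sup>2 = (\<Sum>i\<in>UNIV. \<Sum>j\<in>UNIV. (A $ i $ j)\<^sup>2)"
  by (simp add: norm_vec_def L2_set_def sum_nonneg)

lemma power2_norm_rows: "(norm (A :: real ^ 'm ^ 'n))\<^sup>2 = (\<Sum>i\<in>UNIV. (norm (row i A))\<^sup>2)"
  by (simp add: row_def norm_vec_def L2_set_def sum_nonneg)

lemma norm_transpose: "norm (transpose A) = norm (A :: real ^ 'm ^ 'n)"
proof (rule power2_eq_imp_eq)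
  show "(norm (transpose A))\<^sup>2 = (norm A)\<^sup>2"
    unfolding power2_norm_matrix by (subst sum.swap) (simp add: transpose_def)
qed auto

lemma power2_norm_columns: "(norm (A :: real ^ 'm ^ 'n))\<^sup>2 = (\<Sum>j\<in>UNIV. (norm (column j A))\<^sup>2)"
  using power2_norm_rows[of "transpose A"] by (simp add: norm_transpose)

lemma norm_orthonormal_mult_vec:
  fixes U :: "real ^ 'r ^ 'n"
  assumes "transpose U ** U = mat 1"
  shows "norm (U *v y) = norm y"
proof (rule power2_eq_imp_eq)
  have "(U *v y) \<bullet> (U *v y) = y \<bullet> ((transpose U ** U) *v y)"
    by (metis dot_lmul_matrix matrix_vector_mul_assoc vector_transpose_matrix inner_commute)
  then show "(norm (U *v y))\<^sup>2 = (norm y)\<^sup>2"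
    by (simp add: assms power2_norm_eq_inner)
qed auto

lemma column_matrix_mult: "column j (A ** B) = A *v column j (B :: real ^ 'm ^ 'r)"
  by (simp add: column_def matrix_matrix_mult_def matrix_vector_mult_def vec_eq_iff)

lemma row_matrix_mult: "row i (A ** B) = row i (A :: real ^ 'r ^ 'n) v* B"
  by (simp add: row_def matrix_matrix_mult_def vector_matrix_mult_def vec_eq_iff mult.commute)

lemma norm_orthonormal_mult:
  fixes U :: "real ^ 'r ^ 'n" and B :: "real ^ 'm ^ 'r"
  assumes "transpose U ** U = mat 1"
  shows "norm (U ** B) = norm B"
  by (rule power2_eq_imp_eq)
    (simp_all add: power2_norm_columns column_matrix_mult norm_orthonormal_mult_vec[OF assms])

lemma norm_mult_transpose_orthonormal:
  fixes V :: "real ^ 'r ^ 'm" and B :: "real ^ 'r ^ 'n"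
  assumes "transpose V ** V = mat 1"
  shows "norm (B ** transpose V) = norm B"
  by (metis assms matrix_transpose_mul norm_orthonormal_mult norm_transpose transpose_transpose)

lemma norm_vec_mult_transpose_orthonormal:
  fixes V :: "real ^ 'r ^ 'm"
  assumes "transpose V ** V = mat 1"
  shows "norm (x v* transpose V) = norm x"
  by (simp add: norm_orthonormal_mult_vec[OF assms])

lemma bij_row: "bij (\<lambda>A i. row i (A :: real ^ 'm ^ 'n))"
  by (rule bij_betw_byWitness[where f' = "\<lambda>x. \<chi> i. x i"]) (auto simp: row_def vec_eq_iff)

lemma bij_column: "bij (\<lambda>A j. column j (A :: real ^ 'm ^ 'n))"
  by (rule bij_betw_byWitness[where f' = "\<lambda>x. \<chi> i j. x j $ i"]) (auto simp: column_def vec_eq_iff)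

text \<open>\<open>matrix_inv\<close> is defined by choice, so its value is obtained from
  uniqueness: the diagonal matrix of reciprocals is a two-sided inverse.\<close>

lemma matrix_inv_diagonal:
  fixes S :: "real ^ 'r ^ 'r"
  assumes diag: "\<And>k l. k \<noteq> l \<Longrightarrow> S $ k $ l = 0" and pos: "\<And>k. 0 < S $ k $ k"
  shows "matrix_inv S = (\<chi> k l. if k = l then 1 / S $ k $ k else 0)"
proof -
  let ?T = "\<chi> k l. if k = l then 1 / S $ k $ k else 0"
  have z: "S $ k $ k \<noteq> 0" for k using pos[of k] by simp
  have "(S ** ?T) $ k $ l = mat 1 $ k $ l" for k l
    unfolding matrix_matrix_mult_def mat_def using z
    by (simp add: if_distrib[of "\<lambda>x. _ * x"] diag cong: if_cong)
  then have R: "S ** ?T = mat 1" by (simp add: vec_eq_iff)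
  then have L: "?T ** S = mat 1" by (simp add: matrix_left_right_inverse)
  have "invertible S" using R L by (auto simp: invertible_def)
  then have "matrix_inv S ** S = mat 1" by (auto simp: invertible_def matrix_inv_def intro: someI2_ex)
  then have "matrix_inv S = matrix_inv S ** (S ** ?T)"
    by (simp add: R)
  also have "\<dots> = ?T" by (simp add: matrix_mul_assoc \<open>matrix_inv S ** S = mat 1\<close>)
  finally show ?thesis .
qed

section \<open>Coordinates on pairs of matrices\<close>

lemma sum_Basis_prod:
  fixes f :: "('a::euclidean_space \<times> 'b::euclidean_space) \<Rightarrow> real"
  shows "(\<Sum>b\<in>Basis. f b) = (\<Sum>u\<in>Basis. f (u, 0)) + (\<Sum>v\<in>Basis. f (0, v))"
proof -
  have "inj_on (\<lambda>u. (u::'a, 0::'b)) Basis" "inj_on (\<lambda>v. (0::'a, v::'b)) Basis"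
    by (auto intro!: inj_onI)
  then show ?thesis
    unfolding Basis_prod_def
    by (subst sum.union_disjoint) (auto simp: sum.reindex)
qed

lemma sum_Basis_vec:
  fixes f :: "'a::euclidean_space ^ 'n \<Rightarrow> real"
  shows "(\<Sum>b\<in>Basis. f b) = (\<Sum>i\<in>UNIV. \<Sum>u\<in>Basis. f (axis i u))"
proof -
  have *: "(\<Union>u\<in>Basis. {axis i u}) = (\<lambda>u. axis i u) ` (Basis::'a set)" for i :: 'n by auto
  have inj: "inj_on (axis i) (Basis::'a set)" for i :: 'n
    by (auto intro!: inj_onI simp: axis_eq_axis)
  show ?thesis
    unfolding Basis_vec_def *
    by (subst sum.UNION_disjoint)
      (auto simp: sum.reindex[OF inj] axis_eq_axis)
qed

lemma diag_map_prod:
  assumes "\<And>u. u \<in> Basis \<Longrightarrow> s (u, 0) = \<alpha>" and "\<And>v. v \<in> Basis \<Longrightarrow> s (0, v) = \<beta>"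
  shows "diag_map s z = (\<alpha> *\<^sub>R fst z, \<beta> *\<^sub>R snd z)"
proof (rule euclidean_eqI)
  fix b :: "'a \<times> 'b" assume b: "b \<in> Basis"
  show "diag_map s z \<bullet> b = (\<alpha> *\<^sub>R fst z, \<beta> *\<^sub>R snd z) \<bullet> b"
    unfolding diag_map_inner[OF b] using b by (auto simp: Basis_prod_def assms inner_prod_def)
qed

lemma sum_Basis_matrix:
  fixes f :: "real ^ 'm ^ 'n \<Rightarrow> real"
  shows "(\<Sum>b\<in>Basis. f b) = (\<Sum>i\<in>UNIV. \<Sum>j\<in>UNIV. f (axis i (axis j 1)))"
  by (simp add: sum_Basis_vec)

lemma inner_axis_axis_1: "A \<bullet> axis i (axis j 1) = (A :: real ^ 'm ^ 'n) $ i $ j"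
  by (simp add: inner_axis)

lemma matrix_inv_diagonal_mult:
  fixes S :: "real ^ 'r ^ 'r"
  assumes "\<And>k l. k \<noteq> l \<Longrightarrow> S $ k $ l = 0" and "\<And>k. 0 < S $ k $ k"
  shows "x v* matrix_inv S = (\<chi> k. x $ k / S $ k $ k)"
    and "matrix_inv S *v x = (\<chi> k. x $ k / S $ k $ k)"
  by (simp_all add: matrix_inv_diagonal[OF assms] vec_eq_iff vector_matrix_mult_def
      matrix_vector_mult_def if_distrib[of "\<lambda>a. a * _"] if_distrib[of "\<lambda>a. _ * a"] cong: if_cong)

lemma matrix_mult_nth:
  "(A ** B) $ i $ j = (\<Sum>k\<in>UNIV. A $ i $ k * (B :: real ^ 'm ^ 'r) $ k $ j)"
  by (simp add: matrix_matrix_mult_def)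

lemma diagonal_matrix_mult:
  fixes S :: "real ^ 'r ^ 'r"
  assumes "\<And>k l. k \<noteq> l \<Longrightarrow> S $ k $ l = 0"
  shows "(S ** B) $ k $ j = S $ k $ k * B $ k $ j"
    and "(C ** S) $ i $ k = C $ i $ k * S $ k $ k"
proof -
  have "(S ** B) $ k $ j = (\<Sum>l\<in>UNIV. if l = k then S $ k $ k * B $ k $ j else 0)"
    unfolding matrix_mult_nth by (rule sum.cong) (auto simp: assms)
  then show "(S ** B) $ k $ j = S $ k $ k * B $ k $ j" by simp
  have "(C ** S) $ i $ k = (\<Sum>l\<in>UNIV. if l = k then C $ i $ k * S $ k $ k else 0)"
    unfolding matrix_mult_nth by (rule sum.cong) (auto simp: assms)
  then show "(C ** S) $ i $ k = C $ i $ k * S $ k $ k" by simp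
qed

lemma continuous_on_matrix_mult_nth:
  fixes f :: "'a::topological_space \<Rightarrow> real ^ 'r ^ 'n" and g :: "'a \<Rightarrow> real ^ 'm ^ 'r"
  assumes "continuous_on A f" "continuous_on A g"
  shows "continuous_on A (\<lambda>z. (f z ** g z) $ i $ j)"
  unfolding matrix_mult_nth by (intro continuous_intros assms)

section \<open>Regrouping sums over the observed entries\<close>

lemma sum_row_indices:
  fixes P :: "('n::finite \<times> 'm::finite) set"
  shows "(\<Sum>p\<in>P. f (fst p) (snd p)) = (\<Sum>i\<in>UNIV. \<Sum>j\<in>row_indices P i. f i j)"
proof -
  have "P = Sigma UNIV (row_indices P)" by (force simp: row_indices_def)
  then have "(\<Sum>p\<in>P. f (fst p) (snd p)) = (\<Sum>p\<in>Sigma UNIV (row_indices P). f (fst p) (snd p))" by simp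
  also have "\<dots> = (\<Sum>i\<in>UNIV. \<Sum>j\<in>row_indices P i. f i j)"
    by (subst sum.Sigma) (auto simp: case_prod_beta)
  finally show ?thesis .
qed

lemma sum_col_indices:
  fixes P :: "('n::finite \<times> 'm::finite) set"
  shows "(\<Sum>p\<in>P. f (fst p) (snd p)) = (\<Sum>j\<in>UNIV. \<Sum>i\<in>col_indices P j. f i j)"
proof -
  have "(\<Sum>p\<in>P. f (fst p) (snd p)) = (\<Sum>q\<in>prod.swap ` P. f (snd q) (fst q))"
    by (simp add: sum.reindex)
  also have "\<dots> = (\<Sum>j\<in>UNIV. \<Sum>i\<in>row_indices (prod.swap ` P) j. f i j)"
    by (rule sum_row_indices)
  also have "row_indices (prod.swap ` P) = col_indices P"
    by (force simp: row_indices_def col_indices_def)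
  finally show ?thesis .
qed

subsection \<open>The variational residual\<close>

text \<open>Orthonormality gives \<open>norm (DX ** transpose V) = norm DX\<close> and
  \<open>norm (U ** S ** DY) = norm (S ** DY)\<close>, so the domain is an ellipsoid with weight 1
  on the entries of \<open>DX\<close> and \<open>S $ k $ k\<close> on row \<open>k\<close> of
  \<open>DY\<close>. Neither \<open>v\<close> nor \<open>K\<close> depends on
  \<open>X\<close>.\<close>

lemma variational_residual_left:
  fixes U :: "real ^ 'r ^ 'n" and S :: "real ^ 'r ^ 'r" and V :: "real ^ 'r ^ 'm"
  assumes U: "transpose U ** U = mat 1" and V: "transpose V ** V = mat 1"
    and S: "\<And>k l. k \<noteq> l \<Longrightarrow> S $ k $ l = 0" "\<And>k. 0 < S $ k $ k" and w: "0 < \<omega>"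
  obtains v K where "0 < v" and
    "\<And>X. variational_residual \<omega> M P (U ** S) (transpose V) X (transpose V) =
      v * (\<Sum>p\<in>P. ((X ** transpose V - M) $ fst p $ snd p)\<^sup>2
        + \<omega>\<^sup>2 / real (CARD('n) * CARD('r) + CARD('r) * CARD('m) + 2)
          * (norm (row (fst p) X v* matrix_inv S))\<^sup>2) + K"
proof -
  \<comment> \<open>A basis vector has only one nonzero component, so this sum of norms reads off
    the weight of the matching entry.\<close>
  define c :: "(real ^ 'r ^ 'n) \<times> (real ^ 'm ^ 'r) \<Rightarrow> real"
    where "c b = norm (fst b) + (\<Sum>k\<in>UNIV. S $ k $ k * norm (snd b $ k))" for b
  define s :: "(real ^ 'r ^ 'n) \<times> (real ^ 'm ^ 'r) \<Rightarrow> real"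
    where "s b = (if fst b = 0 then 1 else -1)" for b
  \<comment> \<open>Chosen so that \<open>(DX, DY) \<bullet> u X p\<close> is the entry of
    \<open>X ** DY\<close> at \<open>p\<close>.\<close>
  define u :: "real ^ 'r ^ 'n \<Rightarrow> 'n \<times> 'm \<Rightarrow> (real ^ 'r ^ 'n) \<times> (real ^ 'm ^ 'r)"
    where "u X p = (0, \<chi> k l. if l = snd p then X $ fst p $ k else 0)" for X p
  \<comment> \<open>Everything containing \<open>DX\<close>: odd under
    \<open>DX \<mapsto> -DX\<close> and free of \<open>X\<close>.\<close>
  define h :: "'n \<times> 'm \<Rightarrow> (real ^ 'r ^ 'n) \<times> (real ^ 'm ^ 'r) \<Rightarrow> real"
    where "h p z = (fst z ** (transpose V + snd z)) $ fst p $ snd p" for p z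
  let ?E = "ellipsoid c \<omega>"
  have c_fst: "c (x, 0) = norm x" for x by (simp add: c_def)
  have c_snd: "c (0, axis k (axis j 1)) = S $ k $ k" for k j
  proof -
    have "S $ l $ l * norm (axis k (axis j 1 :: real ^ 'm) $ l) = (if l = k then S $ k $ k else 0)" for l
      by (simp add: axis_def[of k])
    then show ?thesis by (simp add: c_def)
  qed
  have c: "0 < c b" if "b \<in> Basis" for b
    using that S(2) by (auto simp: Basis_prod_def Basis_vec_def c_snd c_fst[simplified])
  have E: "variation_set \<omega> (U ** S) (transpose V) = ?E"
    unfolding variation_set_def ellipsoid_def
    by (auto simp: norm_mult_transpose_orthonormal[OF V] norm_orthonormal_mult[OF U]
        matrix_mul_assoc[symmetric] sum_Basis_prod sum_Basis_matrix inner_axis_axis_1 c_fst c_snd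
        power2_norm_matrix diagonal_matrix_mult[OF S(1)])
  have flip: "diag_map s z = (- fst z, snd z)" for z
    by (subst diag_map_prod[where \<alpha> = "-1" and \<beta> = 1]) (auto simp: s_def)
  have entry: "((X + DX) ** (transpose V + DY) - M) $ fst p $ snd p
      = (X ** transpose V - M) $ fst p $ snd p + (DX, DY) \<bullet> u X p + h p (DX, DY)" for X DX DY p
  proof -
    have "(DX, DY) \<bullet> u X p = (\<Sum>k\<in>UNIV. \<Sum>l\<in>UNIV. DY $ k $ l * (if l = snd p then X $ fst p $ k else 0))"
      by (simp add: u_def inner_vec_def)
    also have "\<dots> = (X ** DY) $ fst p $ snd p"
      unfolding matrix_mult_nth
      by (simp add: if_distrib[of "\<lambda>a. _ * a"] mult.commute cong: if_cong)
    finally show ?thesis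
      by (simp add: h_def matrix_mult_nth sum.distrib algebra_simps)
  qed
  \<comment> \<open>Only column \<open>snd p\<close> of the second component of \<open>u X p\<close>
    is nonzero. Dividing its entries by the weights \<open>S $ k $ k\<close> is what brings in the
    inverse of \<open>S\<close>.\<close>
  have u: "(\<Sum>b\<in>Basis. (u X p \<bullet> b / c b)\<^sup>2) = (norm (row (fst p) X v* matrix_inv S))\<^sup>2" for X p
    by (simp add: u_def sum_Basis_prod sum_Basis_matrix inner_axis_axis_1 c_snd
        matrix_inv_diagonal_mult[OF S] norm_vec_def L2_set_def sum_nonneg row_def
        power_divide if_distrib[of "\<lambda>a. a / _"] if_distrib[of "\<lambda>a. a\<^sup>2"] cong: if_cong)
  have cont: "continuous_on UNIV (h p)" for p
    unfolding h_def by (intro continuous_on_matrix_mult_nth continuous_intros)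
  have s: "\<bar>s b\<bar> = 1" for b by (simp add: s_def)
  have odd: "h p (diag_map s z) = - h p z" for p z
    by (simp add: h_def flip matrix_mult_nth sum_negf)
  have "variational_residual \<omega> M P (U ** S) (transpose V) X (transpose V) =
      measure lborel ?E * (\<Sum>p\<in>P. ((X ** transpose V - M) $ fst p $ snd p)\<^sup>2
        + \<omega>\<^sup>2 / real (CARD('n) * CARD('r) + CARD('r) * CARD('m) + 2)
          * (norm (row (fst p) X v* matrix_inv S))\<^sup>2) + (\<Sum>p\<in>P. LINT z:?E|lborel. (h p z)\<^sup>2)" for X
  proof -
    have "variational_residual \<omega> M P (U ** S) (transpose V) X (transpose V) =
        (LINT z:?E|lborel. (\<Sum>p\<in>P. (((X + fst z) ** (transpose V + snd z) - M) $ fst p $ snd p)\<^sup>2))"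
      unfolding variational_residual_def E sqnorm_on_def by (simp only: case_prod_unfold)
    also have "\<dots> = (LINT z:?E|lborel. (\<Sum>p\<in>P. ((X ** transpose V - M) $ fst p $ snd p + z \<bullet> u X p + h p z)\<^sup>2))"
      by (simp only: entry prod.collapse)
    also have "\<dots> = measure lborel ?E * (\<Sum>p\<in>P. ((X ** transpose V - M) $ fst p $ snd p)\<^sup>2
        + \<omega>\<^sup>2 / (real DIM((real ^ 'r ^ 'n) \<times> (real ^ 'm ^ 'r)) + 2)
          * (\<Sum>b\<in>Basis. (u X p \<bullet> b / c b)\<^sup>2)) + (\<Sum>p\<in>P. LINT z:?E|lborel. (h p z)\<^sup>2)"
      by (rule set_integral_ellipsoid_sum_squares[OF c cont s odd, where u = "u X"
            and a = "\<lambda>p. (X ** transpose V - M) $ fst p $ snd p"])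
        (simp_all add: flip u_def inner_prod_def)
    also have "real DIM((real ^ 'r ^ 'n) \<times> (real ^ 'm ^ 'r)) + 2
        = real (CARD('n) * CARD('r) + CARD('r) * CARD('m) + 2)"
      by simp
    finally show ?thesis unfolding u .
  qed
  moreover have "0 < measure lborel ?E" by (rule measure_ellipsoid_pos[OF c w])
  ultimately show ?thesis using that by blast
qed

text \<open>The mirror image: \<open>S\<close> now multiplies \<open>DX\<close> from the right, so
  the weights belong to the columns of \<open>DX\<close>. The reflection is
  \<open>DY \<mapsto> -DY\<close>, and the part free of \<open>Y\<close> is
  \<open>(U + DX) ** DY\<close>.\<close>

lemma variational_residual_right:
  fixes U :: "real ^ 'r ^ 'n" and S :: "real ^ 'r ^ 'r" and V :: "real ^ 'r ^ 'm"
  assumes U: "transpose U ** U = mat 1" and V: "transpose V ** V = mat 1"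
    and S: "\<And>k l. k \<noteq> l \<Longrightarrow> S $ k $ l = 0" "\<And>k. 0 < S $ k $ k" and w: "0 < \<omega>"
  obtains v K where "0 < v" and
    "\<And>Y. variational_residual \<omega> M P U (S ** transpose V) U Y =
      v * (\<Sum>p\<in>P. ((U ** Y - M) $ fst p $ snd p)\<^sup>2
        + \<omega>\<^sup>2 / real (CARD('n) * CARD('r) + CARD('r) * CARD('m) + 2)
          * (norm (matrix_inv S *v column (snd p) Y))\<^sup>2) + K"
proof -
  define c :: "(real ^ 'r ^ 'n) \<times> (real ^ 'm ^ 'r) \<Rightarrow> real"
    where "c b = (\<Sum>k\<in>UNIV. S $ k $ k * norm (column k (fst b))) + norm (snd b)" for b
  define s :: "(real ^ 'r ^ 'n) \<times> (real ^ 'm ^ 'r) \<Rightarrow> real"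
    where "s b = (if snd b = 0 then 1 else -1)" for b
  define u :: "real ^ 'm ^ 'r \<Rightarrow> 'n \<times> 'm \<Rightarrow> (real ^ 'r ^ 'n) \<times> (real ^ 'm ^ 'r)"
    where "u Y p = (\<chi> i k. if i = fst p then Y $ k $ snd p else 0, 0)" for Y p
  define h :: "'n \<times> 'm \<Rightarrow> (real ^ 'r ^ 'n) \<times> (real ^ 'm ^ 'r) \<Rightarrow> real"
    where "h p z = ((U + fst z) ** snd z) $ fst p $ snd p" for p z
  let ?E = "ellipsoid c \<omega>"
  have col0: "column k (0 :: real ^ 'r ^ 'n) = 0" for k by (simp add: column_def vec_eq_iff)
  have c_snd: "c (0, y) = norm y" for y by (simp add: c_def col0)
  have c_fst: "c (axis i (axis k 1), 0) = S $ k $ k" for i k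
  proof -
    have "column l (axis i (axis k 1) :: real ^ 'r ^ 'n) = (if l = k then axis i 1 else 0)" for l
      by (auto simp: column_def axis_def vec_eq_iff)
    then have "S $ l $ l * norm (column l (axis i (axis k 1) :: real ^ 'r ^ 'n)) = (if l = k then S $ k $ k else 0)" for l
      by simp
    then show ?thesis by (simp add: c_def)
  qed
  have c: "0 < c b" if "b \<in> Basis" for b
    using that S(2) by (auto simp: Basis_prod_def Basis_vec_def c_fst c_snd)
  have E: "variation_set \<omega> U (S ** transpose V) = ?E"
    unfolding variation_set_def ellipsoid_def
    by (auto simp: norm_mult_transpose_orthonormal[OF V] norm_orthonormal_mult[OF U]
        matrix_mul_assoc sum_Basis_prod sum_Basis_matrix inner_axis_axis_1 c_fst c_snd
        power2_norm_matrix diagonal_matrix_mult[OF S(1)] mult.commute)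
  have flip: "diag_map s z = (fst z, - snd z)" for z
    by (subst diag_map_prod[where \<alpha> = 1 and \<beta> = "-1"]) (auto simp: s_def)
  have entry: "((U + DX) ** (Y + DY) - M) $ fst p $ snd p
      = (U ** Y - M) $ fst p $ snd p + (DX, DY) \<bullet> u Y p + h p (DX, DY)" for Y DX DY p
  proof -
    have "(DX, DY) \<bullet> u Y p = (\<Sum>i\<in>UNIV. \<Sum>k\<in>UNIV. DX $ i $ k * (if i = fst p then Y $ k $ snd p else 0))"
      by (simp add: u_def inner_vec_def)
    also have "\<dots> = (DX ** Y) $ fst p $ snd p"
      unfolding matrix_mult_nth
      by (subst sum.swap) (simp add: if_distrib[of "\<lambda>a. _ * a"] cong: if_cong)
    finally show ?thesis
      by (simp add: h_def matrix_mult_nth sum.distrib algebra_simps)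
  qed
  have u: "(\<Sum>b\<in>Basis. (u Y p \<bullet> b / c b)\<^sup>2) = (norm (matrix_inv S *v column (snd p) Y))\<^sup>2" for Y p
  proof -
    have "(\<Sum>b\<in>Basis. (u Y p \<bullet> b / c b)\<^sup>2)
        = (\<Sum>i\<in>UNIV. \<Sum>k\<in>UNIV. if i = fst p then (Y $ k $ snd p / S $ k $ k)\<^sup>2 else 0)"
      by (simp add: u_def sum_Basis_prod sum_Basis_matrix inner_axis_axis_1 c_fst
          if_distrib[of "\<lambda>a. a / _"] if_distrib[of "\<lambda>a. a\<^sup>2"] cong: if_cong)
    also have "\<dots> = (\<Sum>k\<in>UNIV. (Y $ k $ snd p / S $ k $ k)\<^sup>2)"
      by (subst sum.swap) simp
    finally show ?thesis
      by (simp add: matrix_inv_diagonal_mult[OF S] norm_vec_def L2_set_def sum_nonneg column_def power_divide)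
  qed
  have cont: "continuous_on UNIV (h p)" for p
    unfolding h_def by (intro continuous_on_matrix_mult_nth continuous_intros)
  have s: "\<bar>s b\<bar> = 1" for b by (simp add: s_def)
  have odd: "h p (diag_map s z) = - h p z" for p z
    by (simp add: h_def flip matrix_mult_nth sum_negf)
  have "variational_residual \<omega> M P U (S ** transpose V) U Y =
      measure lborel ?E * (\<Sum>p\<in>P. ((U ** Y - M) $ fst p $ snd p)\<^sup>2
        + \<omega>\<^sup>2 / real (CARD('n) * CARD('r) + CARD('r) * CARD('m) + 2)
          * (norm (matrix_inv S *v column (snd p) Y))\<^sup>2) + (\<Sum>p\<in>P. LINT z:?E|lborel. (h p z)\<^sup>2)" for Y
  proof -
    have "variational_residual \<omega> M P U (S ** transpose V) U Y =
        (LINT z:?E|lborel. (\<Sum>p\<in>P. (((U + fst z) ** (Y + snd z) - M) $ fst p $ snd p)\<^sup>2))"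
      unfolding variational_residual_def E sqnorm_on_def by (simp only: case_prod_unfold)
    also have "\<dots> = (LINT z:?E|lborel. (\<Sum>p\<in>P. ((U ** Y - M) $ fst p $ snd p + z \<bullet> u Y p + h p z)\<^sup>2))"
      by (simp only: entry prod.collapse)
    also have "\<dots> = measure lborel ?E * (\<Sum>p\<in>P. ((U ** Y - M) $ fst p $ snd p)\<^sup>2
        + \<omega>\<^sup>2 / (real DIM((real ^ 'r ^ 'n) \<times> (real ^ 'm ^ 'r)) + 2)
          * (\<Sum>b\<in>Basis. (u Y p \<bullet> b / c b)\<^sup>2)) + (\<Sum>p\<in>P. LINT z:?E|lborel. (h p z)\<^sup>2)"
      by (rule set_integral_ellipsoid_sum_squares[OF c cont s odd, where u = "u Y"
            and a = "\<lambda>p. (U ** Y - M) $ fst p $ snd p"])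
        (simp_all add: flip u_def inner_prod_def)
    also have "real DIM((real ^ 'r ^ 'n) \<times> (real ^ 'm ^ 'r)) + 2
        = real (CARD('n) * CARD('r) + CARD('r) * CARD('m) + 2)"
      by simp
    finally show ?thesis unfolding u .
  qed
  moreover have "0 < measure lborel ?E" by (rule measure_ellipsoid_pos[OF c w])
  ultimately show ?thesis using that by blast
qed

section \<open>From the integrals to the row and column problems\<close>

theorem theorem3p5:
  fixes M A :: "real ^ 'm ^ 'n"
    and P :: "('n \<times> 'm) set"
    and U :: "real ^ 'r ^ 'n" and S :: "real ^ 'r ^ 'r" and V :: "real ^ 'r ^ 'm"
    and \<omega> \<zeta>1 \<zeta>2 :: real
    and n m r :: nat
  assumes "n = CARD('n)" and "m = CARD('m)"
    and "\<omega> > 0"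
    and "r = rank A" and "r \<ge> 1" and "CARD('r) = r"
    and "truncated_svd A U S V"
    and "\<zeta>1 = real (n * r) / real (r * (n * r + r * m + 2))"
    and "\<zeta>2 = real (r * m) / real (r * (n * r + r * m + 2))"
  shows
    "(\<exists>Xplus.
       tiebreak_argmin
         (\<lambda>X'. variational_residual \<omega> M P (U ** S) (transpose V) X' (transpose V))
         (\<lambda>X'. norm (X' ** transpose V)) = {Xplus} \<and>
       (\<forall>i. tiebreak_argmin
         (\<lambda>x. sqnorm_on (row_indices P i) (\<lambda>j. (x v* transpose V - row i M) $ j)
              + real (card (row_indices P i)) / real m * \<omega>\<^sup>2 * \<zeta>2 * (norm (x v* matrix_inv S))\<^sup>2)
         (\<lambda>x. norm (x v* transpose V)) = {row i Xplus})) \<and>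
     (\<exists>Yplus.
       tiebreak_argmin
         (\<lambda>Y'. variational_residual \<omega> M P U (S ** transpose V) U Y')
         (\<lambda>Y'. norm (U ** Y')) = {Yplus} \<and>
       (\<forall>j. tiebreak_argmin
         (\<lambda>y. sqnorm_on (col_indices P j) (\<lambda>i. (U *v y - column j M) $ i)
              + real (card (col_indices P j)) / real n * \<omega>\<^sup>2 * \<zeta>1 * (norm (matrix_inv S *v y))\<^sup>2)
         (\<lambda>y. norm (U *v y)) = {column j Yplus}))"
proof -
  have U: "transpose U ** U = mat 1" and V: "transpose V ** V = mat 1"
    and S: "\<And>k l. k \<noteq> l \<Longrightarrow> S $ k $ l = 0" "\<And>k. 0 < S $ k $ k"
    using assms(7) by (auto simp: truncated_svd_def)
  \<comment> \<open>The penalty contributed by a single observed entry, common to the row and the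
    column problem.\<close>
  define t where "t = \<omega>\<^sup>2 / real (CARD('n) * CARD('r) + CARD('r) * CARD('m) + 2)"
  have t: "0 < t" using assms(3) by (simp add: t_def add_nonneg_pos)
  have nmr: "0 < n" "0 < m" "0 < r" using assms(1,2,5) by simp_all
  \<comment> \<open>The factor \<open>r\<close> cancels within \<open>\<zeta>2\<close>, and its
    remaining numerator \<open>m\<close> cancels against the division by \<open>m\<close>.\<close>
  have \<zeta>2: "a / real m * \<omega>\<^sup>2 * \<zeta>2 = a * t" for a
  proof -
    have "\<zeta>2 = real m / real (n * r + r * m + 2)"
      unfolding assms(9) of_nat_mult using nmr(3) by simp
    then show ?thesis using nmr assms(1,2,6) by (simp add: t_def)
  qed
  have \<zeta>1: "a / real n * \<omega>\<^sup>2 * \<zeta>1 = a * t" for a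
  proof -
    have "\<zeta>1 = real n / real (n * r + r * m + 2)"
      unfolding assms(8) of_nat_mult using nmr(3) by simp
    then show ?thesis using nmr assms(1,2,6) by (simp add: t_def)
  qed
  have "S $ k $ k \<noteq> 0" for k using S(2)[of k] by simp
  then have inj: "inj (\<lambda>x. x v* matrix_inv S)" "inj ((*v) (matrix_inv S))"
    by (simp_all add: matrix_inv_diagonal_mult[OF S] inj_def vec_eq_iff)
  have lin: "linear (\<lambda>x. x v* B)" for B :: "real ^ 'k ^ 'r"
    using matrix_vector_mul_linear[of "transpose B"] by simp
  have "\<exists>Xplus.
       tiebreak_argmin
         (\<lambda>X'. variational_residual \<omega> M P (U ** S) (transpose V) X' (transpose V))
         (\<lambda>X'. norm (X' ** transpose V)) = {Xplus} \<and>
       (\<forall>i. tiebreak_argmin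
         (\<lambda>x. sqnorm_on (row_indices P i) (\<lambda>j. (x v* transpose V - row i M) $ j)
              + real (card (row_indices P i)) / real m * \<omega>\<^sup>2 * \<zeta>2 * (norm (x v* matrix_inv S))\<^sup>2)
         (\<lambda>x. norm (x v* transpose V)) = {row i Xplus})"
  proof -
    obtain v K where v: "0 < v" and J: "\<And>X. variational_residual \<omega> M P (U ** S) (transpose V) X (transpose V) =
        v * (\<Sum>p\<in>P. ((X ** transpose V - M) $ fst p $ snd p)\<^sup>2
          + t * (norm (row (fst p) X v* matrix_inv S))\<^sup>2) + K"
      by (rule variational_residual_left[OF U V S assms(3), of M P, folded t_def]) (assumption, rule that)
    have nth: "(X ** transpose V - M) $ i $ j = (row i X v* transpose V - row i M) $ j" for X i j
      by (simp only: row_matrix_mult[symmetric]) (simp add: row_def)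
    show ?thesis
    proof (rule tiebreak_argmin_separable[OF bij_row _ v])
      \<comment> \<open>The penalty depends on an entry only through its row, so summing over the
        observed entries of row \<open>i\<close> multiplies it by
        \<open>card (row_indices P i)\<close>.\<close>
      show "variational_residual \<omega> M P (U ** S) (transpose V) X (transpose V) =
        v * (\<Sum>i\<in>UNIV. sqnorm_on (row_indices P i) (\<lambda>j. (row i X v* transpose V - row i M) $ j)
          + real (card (row_indices P i)) / real m * \<omega>\<^sup>2 * \<zeta>2 * (norm (row i X v* matrix_inv S))\<^sup>2) + K" for X
        unfolding J \<zeta>2 nth
        by (subst sum_row_indices[of "\<lambda>i j. ((row i X v* transpose V - row i M) $ j)\<^sup>2
            + t * (norm (row i X v* matrix_inv S))\<^sup>2"])
          (simp add: sqnorm_on_def sum.distrib mult.assoc)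
      show "(norm (X ** transpose V))\<^sup>2 = (\<Sum>i\<in>UNIV. (norm (row i X v* transpose V))\<^sup>2)" for X
        by (simp add: power2_norm_rows row_matrix_mult)
      \<comment> \<open>A ridge problem whose penalty map is injective because the diagonal of
        \<open>S\<close> has no zero.\<close>
      show "\<exists>x. tiebreak_argmin
         (\<lambda>x. sqnorm_on (row_indices P i) (\<lambda>j. (x v* transpose V - row i M) $ j)
              + real (card (row_indices P i)) / real m * \<omega>\<^sup>2 * \<zeta>2 * (norm (x v* matrix_inv S))\<^sup>2)
         (\<lambda>x. norm (x v* transpose V)) = {x}" for i
        by (rule tiebreak_argmin_ridge[OF lin lin inj(1) t])
          (simp_all only: \<zeta>2 norm_vec_mult_transpose_orthonormal[OF V])
    qed auto
  qed
  moreover have "\<exists>Yplus.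
       tiebreak_argmin
         (\<lambda>Y'. variational_residual \<omega> M P U (S ** transpose V) U Y')
         (\<lambda>Y'. norm (U ** Y')) = {Yplus} \<and>
       (\<forall>j. tiebreak_argmin
         (\<lambda>y. sqnorm_on (col_indices P j) (\<lambda>i. (U *v y - column j M) $ i)
              + real (card (col_indices P j)) / real n * \<omega>\<^sup>2 * \<zeta>1 * (norm (matrix_inv S *v y))\<^sup>2)
         (\<lambda>y. norm (U *v y)) = {column j Yplus})"
  proof -
    obtain v K where v: "0 < v" and J: "\<And>Y. variational_residual \<omega> M P U (S ** transpose V) U Y =
        v * (\<Sum>p\<in>P. ((U ** Y - M) $ fst p $ snd p)\<^sup>2
          + t * (norm (matrix_inv S *v column (snd p) Y))\<^sup>2) + K"
      by (rule variational_residual_right[OF U V S assms(3), of M P, folded t_def]) (assumption, rule that)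
    have nth: "(U ** Y - M) $ i $ j = (U *v column j Y - column j M) $ i" for Y i j
      by (simp only: column_matrix_mult[symmetric]) (simp add: column_def)
    show ?thesis
    proof (rule tiebreak_argmin_separable[OF bij_column _ v])
      show "variational_residual \<omega> M P U (S ** transpose V) U Y =
        v * (\<Sum>j\<in>UNIV. sqnorm_on (col_indices P j) (\<lambda>i. (U *v column j Y - column j M) $ i)
          + real (card (col_indices P j)) / real n * \<omega>\<^sup>2 * \<zeta>1 * (norm (matrix_inv S *v column j Y))\<^sup>2) + K" for Y
        unfolding J \<zeta>1 nth
        by (subst sum_col_indices[of "\<lambda>i j. ((U *v column j Y - column j M) $ i)\<^sup>2
            + t * (norm (matrix_inv S *v column j Y))\<^sup>2"])
          (simp add: sqnorm_on_def sum.distrib mult.assoc)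
      show "(norm (U ** Y))\<^sup>2 = (\<Sum>j\<in>UNIV. (norm (U *v column j Y))\<^sup>2)" for Y
        by (simp add: power2_norm_columns column_matrix_mult)
      show "\<exists>y. tiebreak_argmin
         (\<lambda>y. sqnorm_on (col_indices P j) (\<lambda>i. (U *v y - column j M) $ i)
              + real (card (col_indices P j)) / real n * \<omega>\<^sup>2 * \<zeta>1 * (norm (matrix_inv S *v y))\<^sup>2)
         (\<lambda>y. norm (U *v y)) = {y}" for j
        by (rule tiebreak_argmin_ridge[OF matrix_vector_mul_linear matrix_vector_mul_linear inj(2) t])
          (simp_all only: \<zeta>1 norm_orthonormal_mult_vec[OF U])
    qed auto
  qed
  ultimately show ?thesis by blast
qed

end
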